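(* Let $N\ge 1$ be an integer, let $m\ge 1$ be a divisor of $N$, and let $n\in\mathbb{Z}$. Then $$\sum_{d\mid N}\ \sum_{t=0}^{d-1}\gcd\!\left(N\frac{d}{m},\ N\frac{m}{d},\ N\Big(\frac{t}{m}+\frac{n}{d}\Big)\right)\;=\;\frac{N}{m}\sum_{d\mid N}\ \sum_{l=1}^{\gcd(d,m)}\gcd\!\left(\gcd(d,m),\ n+\frac{l\,d}{\gcd(d,m)}\right).$$
   Context: Sums $\sum_{d\mid N}$ run over the positive divisors $d$ of $N$; since $d$ and $m$ divide $N$, all arguments of the gcds are integers. The gcd is non-negative, with $\gcd(a,0)=|a|$. (The left-hand side is the count of inequivalent massive extrema of the exact superpotential and the right-hand side is the semi-classical count of massive vacua of the $\mathcal{N}=1^\ast$ theory $(\mathrm{SU}(N)/\mathbb{Z}_m)_n$ on a circle; this interpretation is not needed for the claim.) *)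

theory Defs
  imports Complex_Main
begin

end

theory Submission
  imports Defs "HOL-Computational_Algebra.Primes"
begin

text \<open>
  The identity holds divisor by divisor. Put \<open>g = gcd d m\<close>, \<open>d = g u\<close>, \<open>m = g w\<close> with \<open>u\<close> and
  \<open>w\<close> coprime; then \<open>u\<close> divides \<open>N / m\<close>, say \<open>N / m = u q\<close>. On the left, the gcd of the first two
  arguments is \<open>q g gcd(u\<^sup>2, w\<^sup>2) = q g\<close>, so the summand is \<open>q gcd(g, n w + t u)\<close>, which has
  period \<open>g\<close> in \<open>t\<close>. It remains to compare the sums of \<open>gcd(g, n w + t u)\<close> and \<open>gcd(g, n + t u)\<close>
  over a period: replace \<open>w\<close> by some \<open>w + s u\<close> coprime to \<open>g\<close>, and substitute
  \<open>(w + s u) t + n s\<close> for \<open>t\<close> in the first.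
\<close>

text \<open>Taking for \<open>s\<close> the product of the primes that divide \<open>g\<close> but
  not \<open>w\<close> makes every prime factor of \<open>g\<close> divide exactly one of
  \<open>w\<close> and \<open>s * u\<close>, hence not their sum.\<close>

lemma ex_coprime_in_progression:
  fixes w u g :: nat
  assumes "coprime w u" and "g > 0"
  obtains s where "coprime (w + s * u) g"
proof -
  define P where "P = {p. prime p \<and> p dvd g \<and> \<not> p dvd w}"
  define s where "s = \<Prod>P"
  have fin: "finite P"
    by (rule finite_subset[of _ "{..g}"]) (use assms in \<open>auto simp: P_def dest: dvd_imp_le\<close>)
  have "\<not> p dvd w + s * u" if p: "prime p" "p dvd g" for p
  proof (cases "p dvd w")
    case True
    have "\<not> p dvd u"
      using assms(1) True p(1) coprime_common_divisor not_prime_unit by blast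
    moreover have "\<not> p dvd s"
    proof
      assume "p dvd s"
      then obtain r where "r \<in> P" "p dvd r"
        using p fin prime_dvd_prod_iff[of P p "\<lambda>x. x"] by (auto simp: s_def)
      then show False
        using True p primes_dvd_imp_eq[of p r] by (auto simp: P_def)
    qed
    ultimately show ?thesis
      using True p by (simp add: dvd_add_right_iff prime_dvd_mult_iff)
  next
    case False
    with p fin have "p dvd s"
      unfolding s_def by (intro dvd_prodI[of P p "\<lambda>x. x", simplified]) (auto simp: P_def)
    with False show ?thesis
      by (simp add: dvd_add_left_iff)
  qed
  then have "coprime (w + s * u) g"
    using prime_factor_nat[of "gcd (w + s * u) g"] by (auto simp: coprime_iff_gcd_eq_1)
  then show thesis by (rule that)
qed

text \<open>Since \<open>a\<close> is a unit modulo \<open>g\<close>, the affine map permutes the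
  residues, and periodicity lets \<open>F\<close> see only residues.\<close>

lemma sum_periodic_affine:
  fixes F :: "int \<Rightarrow> 'a::comm_monoid_add" and a b :: int
  assumes per: "\<And>x. F (x mod int g) = F x" and cop: "coprime a (int g)"
  shows "(\<Sum>t<g. F (a * int t + b)) = (\<Sum>t<g. F (int t))"
proof (cases "g = 0")
  case False
  define h where "h t = nat ((a * int t + b) mod int g)" for t
  have inth: "int (h t) = (a * int t + b) mod int g" for t
    using False by (simp add: h_def)
  have img: "h ` {..<g} \<subseteq> {..<g}"
    using False by (auto simp: h_def nat_less_iff)
  have "inj_on h {..<g}"
  proof (rule inj_onI)
    fix x y assume xy: "x \<in> {..<g}" "y \<in> {..<g}" "h x = h y"
    then have "(a * int x + b) mod int g = (a * int y + b) mod int g"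
      using inth by metis
    then have "int g dvd a * (int x - int y)"
      by (simp add: mod_eq_dvd_iff algebra_simps)
    then have "int g dvd int x - int y"
      using cop by (simp add: coprime_commute coprime_dvd_mult_right_iff)
    then have "int x mod int g = int y mod int g"
      by (simp add: mod_eq_dvd_iff)
    then show "x = y"
      using xy by simp
  qed
  then have "bij_betw h {..<g} {..<g}"
    using img by (simp add: bij_betw_def endo_inj_surj)
  then have "(\<Sum>t<g. F (int (h t))) = (\<Sum>t<g. F (int t))"
    by (rule sum.reindex_bij_betw)
  then show ?thesis
    by (simp add: inth per)
qed simp

lemma sum_periodic_multiple:
  fixes F :: "int \<Rightarrow> int"
  assumes per: "\<And>x. F (x mod int g) = F x"
  shows "(\<Sum>t<u * g. F (int t)) = int u * (\<Sum>t<g. F (int t))"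
proof -
  \<comment> \<open>Each of the \<open>u\<close> consecutive blocks of length \<open>g\<close>
    contributes one full period.\<close>
  have "(\<Sum>t = i * g..<i * g + g. F (int t)) = (\<Sum>t<g. F (int t))" for i
  proof -
    have "(\<Sum>t = i * g..<i * g + g. F (int t)) = (\<Sum>t<g. F (int (t + i * g)))"
      using sum.shift_bounds_nat_ivl[of "\<lambda>t. F (int t)" 0 "i * g" g]
      by (simp add: add.commute lessThan_atLeast0)
    also have "\<dots> = (\<Sum>t<g. F (int t))"
    proof (rule sum.cong)
      fix t
      have "F (int (t + i * g)) = F (int (t + i * g) mod int g)" by (simp only: per)
      also have "int (t + i * g) mod int g = int t mod int g" by simp
      finally show "F (int (t + i * g)) = F (int t)" by (simp only: per)
    qed simp
    finally show ?thesis .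
  qed
  then show ?thesis
    by (simp add: sum.nat_group[of "\<lambda>t. F (int t)" g u, symmetric])
qed

text \<open>Supplies the periodicity hypothesis of both summation lemmas.\<close>

lemma gcd_add_mod_mult:
  fixes g c u x :: int
  shows "gcd g (c + (x mod g) * u) = gcd g (c + x * u)"
proof -
  have "(c + (x mod g) * u) mod g = (c + x * u) mod g"
    by (metis mod_add_right_eq mod_mult_left_eq)
  then show ?thesis
    by (metis gcd_red_int gcd.commute)
qed

text \<open>For \<open>v = w + s * u\<close> coprime to \<open>g\<close>, multiplication by
  \<open>v\<close> preserves the gcd with \<open>g\<close>, and
  \<open>v * (n + x * u) = n * w + (v * x + n * s) * u\<close> exhibits the result as an affine
  substitution.\<close>

lemma sum_gcd_progression_scale:
  fixes g u w :: nat and n :: int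
  assumes "coprime w u" and "g > 0"
  shows "(\<Sum>l = 1..g. gcd (int g) (n + int l * int u)) =
         (\<Sum>t<g. gcd (int g) (n * int w + int t * int u))"
proof -
  obtain s where s: "coprime (w + s * u) g"
    using ex_coprime_in_progression[OF assms] .
  define v where "v = int (w + s * u)"
  have v: "coprime v (int g)"
    using s by (simp only: v_def coprime_int_iff)
  define F where "F x = gcd (int g) (n * int w + x * int u)" for x
  have per: "F (x mod int g) = F x" for x
    unfolding F_def by (rule gcd_add_mod_mult)
  \<comment> \<open>The left sum starts at 1, so \<open>l = Suc t\<close> adds an extra
    \<open>v\<close> to the shift \<open>n * int s\<close>.\<close>
  have "gcd (int g) (n + int (Suc t) * int u) = F (v * int t + (v + n * int s))" for t
  proof -
    have "gcd (int g) (n + int (Suc t) * int u) = gcd (int g) (v * (n + int (Suc t) * int u))"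
      using v by (simp add: coprime_commute gcd_mult_left_left_cancel gcd_mult_right_left_cancel)
    also have "v * (n + int (Suc t) * int u) =
               n * int w + (v * int t + (v + n * int s)) * int u"
      by (simp add: v_def algebra_simps)
    finally show ?thesis
      by (simp add: F_def)
  qed
  then have "(\<Sum>l = 1..g. gcd (int g) (n + int l * int u)) =
             (\<Sum>t<g. F (v * int t + (v + n * int s)))"
    by (simp only: One_nat_def sum.atLeast_Suc_atMost_Suc_shift sum.atLeast1_atMost_eq)
  also have "\<dots> = (\<Sum>t<g. F (int t))"
    using per v by (rule sum_periodic_affine)
  finally show ?thesis
    by (simp add: F_def)
qed

lemma divisor_summand_eq:
  fixes N m d :: nat and n :: int
  assumes "N > 0" and "m dvd N" and "d dvd N"
  shows "(\<Sum>t = 0..<d.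
            gcd (gcd (int (N * d) div int m) (int (N * m) div int d))
                (int (N * t) div int m + (int N * n) div int d))
       = int (N div m) *
         (\<Sum>l = 1..gcd d m. gcd (int (gcd d m)) (n + int (l * d) div int (gcd d m)))"
proof -
  define g where "g = gcd d m"
  have pos: "d > 0" "m > 0"
    using assms by (auto intro: dvd_pos_nat)
  then have g: "g > 0"
    by (simp add: g_def)
  obtain u w where d: "d = u * g" and m: "m = w * g" and cop: "coprime u w"
    using gcd_coprime_exists[of d m] g unfolding g_def by auto
  obtain k where k: "N = m * k"
    using assms(2) by blast
  \<comment> \<open>Cancel \<open>g\<close> from \<open>d dvd N\<close>; coprimality of
    \<open>u\<close> and \<open>w\<close> then gives that \<open>u\<close> divides \<open>k\<close>,
    which is \<open>N div m\<close>.\<close>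
  have "u dvd w * k"
  proof -
    have "u * g dvd (w * k) * g"
      using assms(3) by (simp add: k d m mult.assoc mult.commute[of g])
    with g show ?thesis by simp
  qed
  then obtain q where q: "k = u * q"
    using cop by (auto simp: coprime_dvd_mult_right_iff)
  \<comment> \<open>Every \<open>div\<close> in the summand is exact, so writing the dividend as a
    multiple of the divisor evaluates it.\<close>
  have div_eq: "x div int y = z" if "x = int y * z" "y > 0" for x y z
    using that by simp
  have summand: "gcd (gcd (int (N * d) div int m) (int (N * m) div int d))
                   (int (N * t) div int m + (int N * n) div int d)
               = int q * gcd (int g) (n * int w + int t * int u)" for t
  proof -
    have "int (N * d) = int m * (int (q * g) * int (u\<^sup>2))"
      by (simp add: k d m q power2_eq_square algebra_simps)
    then have 1: "int (N * d) div int m = int (q * g) * int (u\<^sup>2)"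
      using pos by (intro div_eq)
    have "int (N * m) = int d * (int (q * g) * int (w\<^sup>2))"
      by (simp add: k d m q power2_eq_square algebra_simps)
    then have 2: "int (N * m) div int d = int (q * g) * int (w\<^sup>2)"
      using pos by (intro div_eq)
    have "int (N * t) = int m * (int q * (int t * int u))"
      by (simp add: k q algebra_simps)
    then have 3: "int (N * t) div int m = int q * (int t * int u)"
      using pos by (intro div_eq)
    have "int N * n = int d * (int q * (n * int w))"
      by (simp add: k d m q algebra_simps)
    then have 4: "int N * n div int d = int q * (n * int w)"
      using pos by (intro div_eq)
    have "coprime (int (u\<^sup>2)) (int (w\<^sup>2))"
      using cop by (simp only: coprime_int_iff) simp
    then have 5: "gcd (int (q * g) * int (u\<^sup>2)) (int (q * g) * int (w\<^sup>2)) = int q * int g"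
      by (simp only: gcd_mult_left coprime_iff_gcd_eq_1) simp
    show ?thesis
      unfolding 1 2 3 4 5
      by (simp add: gcd_mult_left distrib_left[symmetric] add.commute del: of_nat_mult)
  qed
  \<comment> \<open>The range of length \<open>d = u * g\<close> holds \<open>u\<close> full
    periods; this \<open>u\<close> and the \<open>q\<close> from the summand make up
    \<open>N div m\<close>.\<close>
  have "(\<Sum>t = 0..<d. gcd (int g) (n * int w + int t * int u)) =
        int u * (\<Sum>t<g. gcd (int g) (n * int w + int t * int u))"
    unfolding d lessThan_atLeast0[symmetric] by (intro sum_periodic_multiple gcd_add_mod_mult)
  also have "\<dots> = int u * (\<Sum>l = 1..g. gcd (int g) (n + int l * int u))"
    using sum_gcd_progression_scale[of w u g n] cop g by (simp add: coprime_commute)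
  finally have inner: "(\<Sum>t = 0..<d. gcd (int g) (n * int w + int t * int u)) =
        int u * (\<Sum>l = 1..g. gcd (int g) (n + int l * int u))" .
  have 6: "int (l * d) div int g = int l * int u" for l
    using g by (simp add: d)
  have 7: "int (N div m) = int q * int u"
    using pos by (simp add: k q)
  show ?thesis
    unfolding summand g_def[symmetric] 6 7
    by (simp only: sum_distrib_left[symmetric] inner mult.assoc)
qed

theorem mainTheorem3:
  fixes N m :: nat and n :: int
  assumes "N \<ge> 1" and "m \<ge> 1" and "m dvd N"
  shows "(\<Sum>d | d dvd N. \<Sum>t = 0..<d.
            gcd (gcd (int (N * d) div int m) (int (N * m) div int d))
                (int (N * t) div int m + (int N * n) div int d))
       = int (N div m) *
         (\<Sum>d | d dvd N. \<Sum>l = 1..gcd d m.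
            gcd (int (gcd d m)) (n + int (l * d) div int (gcd d m)))"
  unfolding sum_distrib_left[of "int (N div m)" _ "{d. d dvd N}"]
proof (rule sum.cong[OF refl], rule divisor_summand_eq)
qed (use assms in auto)

end
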